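(* For every integer $n\ge 1$, let $T_n$ be the number of different ways in which a parallelepiped (tower) with sizes $2\times 2\times n$ can be filled with domino bricks of sizes $1\times 1\times 2$. Then $$T_n=\frac{1}{6}\left(2+\sqrt{3}\right)^{n+1}+\frac{1}{6}\left(2-\sqrt{3}\right)^{n+1}+\frac{1}{3}(-1)^n .$$
   Context: Identify the unit cubes of the tower with the points of $\{1,2\}\times\{1,2\}\times\{1,\dots,n\}\subset\mathbb{Z}^3$. A domino brick is a $1\times1\times2$ parallelepiped in any of the three axis-parallel orientations, i.e. a pair of unit cubes sharing a face (two points differing by $1$ in exactly one coordinate). A filling of the tower with domino bricks is a partition of its set of unit cubes into domino bricks; fillings are counted as distinct partitions (no identification under symmetry). *)

theory Defs
  imports Complex_Main "HOL-Library.Disjoint_Sets"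
begin

type_synonym cube = "int \<times> int \<times> int"

definition tower :: "nat \<Rightarrow> cube set" where
  "tower n = {1, 2} \<times> {1, 2} \<times> {1..int n}"

fun share_face :: "cube \<Rightarrow> cube \<Rightarrow> bool" where
  "share_face (x, y, z) (x', y', z') \<longleftrightarrow>
     (\<bar>x - x'\<bar> = 1 \<and> y = y' \<and> z = z') \<or>
     (x = x' \<and> \<bar>y - y'\<bar> = 1 \<and> z = z') \<or>
     (x = x' \<and> y = y' \<and> \<bar>z - z'\<bar> = 1)"

definition domino :: "cube set \<Rightarrow> bool" where
  "domino B \<longleftrightarrow> (\<exists>p q. share_face p q \<and> B = {p, q})"

definition fillings :: "cube set \<Rightarrow> cube set set set" where
  "fillings R = {P. partition_on R P \<and> (\<forall>B\<in>P. domino B)}"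

text \<open>\<open>card\<close> is 0 on infinite sets, so finiteness is recorded for \<open>T\<close> below.\<close>

lemma finite_fillings: "finite R \<Longrightarrow> finite (fillings R)"
  by (rule finite_subset[of _ "Pow (Pow R)"]) (auto simp: fillings_def partition_on_def)

lemma finite_tower: "finite (tower n)"
  by (simp add: tower_def)

definition T :: "nat \<Rightarrow> nat" where
  "T n = card (fillings (tower n))"

end

theory Submission
  imports Defs
begin

text \<open>
  Fix a cube of a region. Its domino joins it to one of its neighbours in the region, so the number
  of fillings is the sum, over these neighbours, of the number of fillings of what remains
  (\<open>card_fillings_expand\<close>). Applied to the cubes of the top layer of the tower, one after the other,
  this gives recurrences. Write \<open>P n\<close> for the number of fillings of a tower of height \<open>n\<close> that
  carries two adjacent cubes in layer \<open>n + 1\<close>. These two cubes form one domino, or each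
  of them reaches down into layer \<open>n\<close>, whose other two cubes are again adjacent; hence
  \<open>P n = T n + P (n - 1)\<close> and \<open>P n = T 0 + \<dots> + T n\<close>. In a complete top layer, a chosen
  corner has a horizontal domino in \<open>2 P (n + 1)\<close> of the fillings of the tower of height \<open>n + 2\<close>.
  Otherwise it reaches down, and the other three corners contain one horizontal domino
  (\<open>2 P n\<close> fillings) or none (\<open>T n\<close> fillings). So
  \<open>T (n + 2) = 2 P (n + 1) + 2 P n + T n\<close>,
  and subtracting two consecutive instances eliminates the sums:
  \<open>T (n + 3) + T n = 3 T (n + 2) + 3 T (n + 1)\<close>.
  The characteristic polynomial \<open>x^3 - 3 x^2 - 3 x + 1 = (x + 1) (x^2 - 4 x + 1)\<close> has the roots
  \<open>-1\<close> and \<open>2 \<plusminus> sqrt 3\<close>, and the coefficients come from \<open>T 0 = 1\<close>, \<open>T 1 = 2\<close>, \<open>T 2 = 9\<close>.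
\<close>

section \<open>Fillings and the domino at a given cube\<close>

lemma share_face_commute: "share_face p q \<longleftrightarrow> share_face q p"
  by (cases p; cases q) auto

lemma fillings_empty: "fillings {} = {{}}"
  by (auto simp: fillings_def partition_on_empty)

lemma insert_domino_filling:
  assumes "share_face p q" "p \<in> R" "q \<in> R" "P \<in> fillings (R - {p, q})"
  shows "insert {p, q} P \<in> fillings R"
proof -
  have P: "partition_on (R - {p, q}) P" "\<forall>B\<in>P. domino B"
    using assms(4) by (auto simp: fillings_def)
  then have "disjnt {p, q} (\<Union>P)"
    unfolding partition_on_def disjnt_def by blast
  then have "partition_on R (insert {p, q} P)"
    using P(1) assms(2,3) by (simp add: partition_on_insert)
  moreover have "domino {p, q}"
    using assms(1) unfolding domino_def by blast
  ultimately show ?thesis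
    using P(2) by (simp add: fillings_def)
qed

lemma remove_domino_filling:
  assumes "P \<in> fillings R" "{p, q} \<in> P"
  shows "P - {{p, q}} \<in> fillings (R - {p, q})"
proof -
  have P: "partition_on R P" "\<forall>B\<in>P. domino B"
    using assms(1) by (auto simp: fillings_def)
  have "{p, q} \<inter> B = {}" if "B \<in> P - {{p, q}}" for B
    using that by (intro disjointD[OF partition_onD2[OF P(1)] assms(2)]) auto
  then have "disjnt {p, q} (\<Union>(P - {{p, q}}))"
    unfolding disjnt_def by blast
  moreover have "partition_on R (insert {p, q} (P - {{p, q}}))"
    using P(1) assms(2) by (simp add: insert_absorb)
  ultimately have "partition_on (R - {p, q}) (P - {{p, q}})"
    using partition_on_insert by blast
  then show ?thesis
    using P(2) by (simp add: fillings_def)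
qed

lemma filling_domino_at:
  assumes "P \<in> fillings R" "p \<in> R"
  obtains q where "q \<in> R" "share_face p q" "{p, q} \<in> P"
proof -
  obtain B where B: "B \<in> P" "p \<in> B"
    using assms by (auto simp: fillings_def partition_on_def)
  then have "domino B"
    using assms by (simp add: fillings_def)
  then obtain u v where uv: "share_face u v" "B = {u, v}"
    unfolding domino_def by blast
  have "B \<subseteq> R"
    using assms B by (auto simp: fillings_def partition_on_def)
  show ?thesis
  proof (cases "p = u")
    case True
    then show ?thesis using that[of v] B uv \<open>B \<subseteq> R\<close> by auto
  next
    case False
    then show ?thesis
      using that[of u] B uv \<open>B \<subseteq> R\<close> share_face_commute by (auto simp: insert_commute)
  qed
qed

text \<open>
  Removing the domino that covers \<open>p\<close> is a bijection from the fillings in which it is \<open>{p, q}\<close> to the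
  fillings of \<open>R - {p, q}\<close>.
\<close>
lemma card_fillings_expand:
  assumes "finite R" "p \<in> R"
  shows "card (fillings R) = (\<Sum>q | q \<in> R \<and> share_face p q. card (fillings (R - {p, q})))"
proof -
  define N where "N = {q. q \<in> R \<and> share_face p q}"
  define A where "A q = {P \<in> fillings R. {p, q} \<in> P}" for q
  have fin: "finite (fillings R)" "finite N"
    using assms finite_fillings by (auto simp: N_def)
  have "fillings R = (\<Union>q\<in>N. A q)"
  proof (intro equalityI subsetI)
    fix P assume P: "P \<in> fillings R"
    obtain q where "q \<in> R" "share_face p q" "{p, q} \<in> P"
      using filling_domino_at[OF P assms(2)] .
    then show "P \<in> (\<Union>q\<in>N. A q)"
      using P unfolding A_def N_def by blast
  qed (auto simp: A_def)
  moreover have "A q \<inter> A q' = {}" if "q \<noteq> q'" for q q'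
  proof -
    have False if "P \<in> A q" "P \<in> A q'" for P
    proof -
      have "disjoint P"
        using that by (auto simp: A_def fillings_def partition_on_def)
      then have "{p, q} = {p, q'}"
        using that disjointD[of P "{p, q}" "{p, q'}"] unfolding A_def by blast
      then show False
        using \<open>q \<noteq> q'\<close> by (auto simp: doubleton_eq_iff)
    qed
    then show ?thesis by auto
  qed
  moreover have "finite (A q)" for q
    using fin(1) by (simp add: A_def)
  ultimately have "card (fillings R) = (\<Sum>q\<in>N. card (A q))"
    using fin(2) by (simp add: card_UN_disjoint)
  also have "\<dots> = (\<Sum>q\<in>N. card (fillings (R - {p, q})))"
  proof (rule sum.cong[OF refl])
    fix q assume "q \<in> N"
    then have q: "q \<in> R" "share_face p q" by (auto simp: N_def)
    have "bij_betw (\<lambda>P. P - {{p, q}}) (A q) (fillings (R - {p, q}))"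
    proof (rule bij_betw_byWitness[where f' = "insert {p, q}"])
      have "{p, q} \<notin> P" if "P \<in> fillings (R - {p, q})" for P
        using that by (auto simp: fillings_def partition_on_def)
      then show "\<forall>P\<in>fillings (R - {p, q}). insert {p, q} P - {{p, q}} = P" by simp
    qed (use q assms(2) in \<open>auto simp: A_def intro: insert_domino_filling remove_domino_filling\<close>)
    then show "card (A q) = card (fillings (R - {p, q}))"
      by (rule bij_betw_same_card)
  qed
  finally show ?thesis by (simp add: N_def)
qed

section \<open>Covering the top layer\<close>

definition square :: "(int \<times> int) set" where
  "square = {(1, 1), (1, 2), (2, 1), (2, 2)}"

text \<open>
  The shapes that occur while the top layer is being covered: full layers strictly below height \<open>h\<close>,
  the cross-section \<open>U\<close> at height \<open>h\<close> and the cross-section \<open>S\<close> at height \<open>h + 1\<close>. An integer height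
  permits \<open>h = 0\<close> with \<open>U = {}\<close>, where \<open>S\<close> rests on the ground.
\<close>
definition stack :: "int \<Rightarrow> (int \<times> int) set \<Rightarrow> (int \<times> int) set \<Rightarrow> cube set" where
  "stack h U S = {(x, y, z). (x, y) \<in> square \<and> 1 \<le> z \<and> z < h
     \<or> (x, y) \<in> U \<and> z = h \<or> (x, y) \<in> S \<and> z = h + 1}"

definition W :: "int \<Rightarrow> (int \<times> int) set \<Rightarrow> (int \<times> int) set \<Rightarrow> nat" where
  "W h U S = card (fillings (stack h U S))"

lemma finite_stack:
  assumes "U \<subseteq> square" "S \<subseteq> square"
  shows "finite (stack h U S)"
proof (rule finite_subset)
  let ?B = "(\<lambda>((x, y), z). (x, y, z)) ` (square \<times> ({1..h} \<union> {h, h + 1}))"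
  show "stack h U S \<subseteq> ?B"
    using assms by (force simp: stack_def)
  show "finite ?B" by (simp add: square_def)
qed

text \<open>
  A cube in the top layer has at most three neighbours: the one below it and, as the coordinates are
  1 and 2, the ones obtained by the reflections \<open>x \<mapsto> 3 - x\<close> and \<open>y \<mapsto> 3 - y\<close>.
\<close>
lemma W_expand:
  assumes U: "U \<subseteq> square" and S: "S \<subseteq> square" and p: "(x, y) \<in> S"
  shows "W h U S = (if (x, y) \<in> U then W h (U - {(x, y)}) (S - {(x, y)}) else 0)
    + (if (3 - x, y) \<in> S then W h U (S - {(x, y), (3 - x, y)}) else 0)
    + (if (x, 3 - y) \<in> S then W h U (S - {(x, y), (x, 3 - y)}) else 0)"
proof -
  let ?R = "stack h U S" and ?p = "(x, y, h + 1)"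
  define f where "f q = card (fillings (?R - {?p, q}))" for q
  let ?D = "if (x, y) \<in> U then {(x, y, h)} else {}"
  let ?X = "if (3 - x, y) \<in> S then {(3 - x, y, h + 1)} else {}"
  let ?Y = "if (x, 3 - y) \<in> S then {(x, 3 - y, h + 1)} else {}"
  have xy: "x = 1 \<or> x = 2" "y = 1 \<or> y = 2"
    using S p by (auto simp: square_def)
  have R: "?p \<in> ?R" "finite ?R"
    using p U S finite_stack by (auto simp: stack_def)
  have "{q. q \<in> ?R \<and> share_face ?p q} = ?D \<union> ?X \<union> ?Y"
  proof (intro equalityI subsetI)
    fix q assume "q \<in> {q. q \<in> ?R \<and> share_face ?p q}"
    moreover obtain x' y' z' where q: "q = (x', y', z')" by (cases q)
    ultimately have q': "q \<in> ?R" "share_face ?p (x', y', z')" by auto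
    then have "(x', y') \<in> square"
      using U S by (auto simp: stack_def q)
    then have "x' = 1 \<or> x' = 2" "y' = 1 \<or> y' = 2"
      by (auto simp: square_def)
    then have "\<bar>x - x'\<bar> = 1 \<Longrightarrow> x' = 3 - x" "\<bar>y - y'\<bar> = 1 \<Longrightarrow> y' = 3 - y"
      using xy by auto
    moreover have "\<bar>h + 1 - z'\<bar> = 1 \<Longrightarrow> z' = h \<or> z' = h + 2"
      by linarith
    ultimately consider "q = (x, y, h)" | "q = (x, y, h + 2)"
      | "q = (3 - x, y, h + 1)" | "q = (x, 3 - y, h + 1)"
      using q'(2) unfolding q share_face.simps prod.inject by metis
    then show "q \<in> ?D \<union> ?X \<union> ?Y"
      by cases (use q'(1) in \<open>auto simp: stack_def\<close>)
  next
    fix q assume "q \<in> ?D \<union> ?X \<union> ?Y"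
    then show "q \<in> {q. q \<in> ?R \<and> share_face ?p q}"
      using xy by (auto simp: stack_def split: if_splits)
  qed
  then have "W h U S = sum f (?D \<union> ?X \<union> ?Y)"
    unfolding W_def f_def using card_fillings_expand[OF R(2,1)] by simp
  also have "\<dots> = sum f ?D + sum f ?X + sum f ?Y"
    using xy by (subst sum.union_disjoint; auto)+
  also have "sum f ?D = (if (x, y) \<in> U then W h (U - {(x, y)}) (S - {(x, y)}) else 0)"
  proof -
    have "?R - {?p, (x, y, h)} = stack h (U - {(x, y)}) (S - {(x, y)})"
      by (auto simp: stack_def)
    then show ?thesis by (simp add: f_def W_def)
  qed
  also have "sum f ?X = (if (3 - x, y) \<in> S then W h U (S - {(x, y), (3 - x, y)}) else 0)"
  proof -
    have "?R - {?p, (3 - x, y, h + 1)} = stack h U (S - {(x, y), (3 - x, y)})"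
      by (auto simp: stack_def)
    then show ?thesis by (simp add: f_def W_def)
  qed
  also have "sum f ?Y = (if (x, 3 - y) \<in> S then W h U (S - {(x, y), (x, 3 - y)}) else 0)"
  proof -
    have "?R - {?p, (x, 3 - y, h + 1)} = stack h U (S - {(x, y), (x, 3 - y)})"
      by (auto simp: stack_def)
    then show ?thesis by (simp add: f_def W_def)
  qed
  finally show ?thesis .
qed

lemma W_shift: "h \<ge> 1 \<Longrightarrow> W (h + 1) S {} = W h square S"
  unfolding W_def by (rule arg_cong[where f = "\<lambda>R. card (fillings R)"]) (auto simp: stack_def)

lemma W_ground: "W 1 S {} = W 0 {} S"
  unfolding W_def by (rule arg_cong[where f = "\<lambda>R. card (fillings R)"]) (auto simp: stack_def)

lemma T_eq_W: "T n = W (int n + 1) {} {}"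
  unfolding W_def T_def
  by (rule arg_cong[where f = "\<lambda>R. card (fillings R)"])
    (auto simp: stack_def tower_def square_def)

lemma T_Suc_eq_W: "T (Suc n) = W (int n + 1) square {}"
  using W_shift[of "int n + 1" "{}"] W_shift[of "int n + 1" square]
  by (simp add: T_eq_W add.commute)

lemma T_0: "T 0 = 1"
  by (simp add: T_def tower_def fillings_empty)

definition sides :: "(int \<times> int) set set" where
  "sides = {{(1, 1), (1, 2)}, {(2, 1), (2, 2)}, {(1, 1), (2, 1)}, {(1, 2), (2, 2)}}"

lemma W_singleton:
  assumes "U \<subseteq> square" "p \<in> square"
  shows "W h U {p} = (if p \<in> U then W h (U - {p}) {} else 0)"
proof -
  obtain x y where p: "p = (x, y)" by (cases p)
  have "x \<noteq> 3 - x" "y \<noteq> 3 - y" by presburger+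
  then show ?thesis
    using assms W_expand[of U "{p}" x y h] by (simp add: p)
qed

text \<open>
  Two adjacent cubes of the top layer form a domino, or each is joined to the cube below it; the
  latter requires both cubes below to be present.
\<close>
lemma W_pair:
  assumes "U \<subseteq> square" "{(x, y), (x', y')} \<subseteq> square"
    and adj: "x' = 3 - x \<and> y' = y \<or> x' = x \<and> y' = 3 - y"
  shows "W h U {(x, y), (x', y')} = W h U {}
    + (if {(x, y), (x', y')} \<subseteq> U then W h (U - {(x, y), (x', y')}) {} else 0)"
proof -
  let ?p = "(x, y)" and ?q = "(x', y')"
  have neq: "x \<noteq> 3 - x" "y \<noteq> 3 - y" by presburger+
  then have pq: "?p \<noteq> ?q" using adj by auto
  have q: "?q \<in> square" using assms(2) by simp
  have "W h U {?p, ?q} = (if ?p \<in> U then W h (U - {?p}) ({?p, ?q} - {?p}) else 0) + W h U {}"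
    using adj neq by (subst W_expand[OF assms(1,2), of x y]) auto
  also have "{?p, ?q} - {?p} = {?q}"
    using pq by auto
  also have "W h (U - {?p}) {?q} = (if ?q \<in> U then W h (U - {?p, ?q}) {} else 0)"
    using assms(1) pq by (subst W_singleton[OF _ q]) (auto simp: Diff_insert2[of U ?p "{?q}"])
  finally show ?thesis by simp
qed

lemma W_side:
  assumes "S \<in> sides"
  shows "W h square S = W h square {} + W h (square - S) {}"
    and "W h {} S = W h {} {}"
proof -
  obtain x y x' y' where S: "S = {(x, y), (x', y')}" "S \<subseteq> square"
    and adj: "x' = 3 - x \<and> y' = y \<or> x' = x \<and> y' = 3 - y"
  proof -
    consider "S = {(1, 1), (1, 2)}" | "S = {(2, 1), (2, 2)}" | "S = {(1, 1), (2, 1)}"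
      | "S = {(1, 2), (2, 2)}"
      using assms unfolding sides_def by blast
    then show thesis
    proof cases
      case 1 then show ?thesis by (intro that[of 1 1 1 2]) (simp_all add: square_def)
    next
      case 2 then show ?thesis by (intro that[of 2 1 2 2]) (simp_all add: square_def)
    next
      case 3 then show ?thesis by (intro that[of 1 1 2 1]) (simp_all add: square_def)
    next
      case 4 then show ?thesis by (intro that[of 1 2 2 2]) (simp_all add: square_def)
    qed
  qed
  show "W h square S = W h square {} + W h (square - S) {}"
    using W_pair[OF subset_refl _ adj, of h] S by simp
  show "W h {} S = W h {} {}"
    using W_pair[OF empty_subsetI _ adj, of h] S by simp
qed

text \<open>
  The two adjacent cubes reach down onto one side of the layer below and leave the opposite side, so
  the induction treats all four sides at once.
\<close>
lemma W_side_eq_sum: "S \<in> sides \<Longrightarrow> W (int n + 1) S {} = (\<Sum>k\<le>n. T k)"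
proof (induction n arbitrary: S)
  case 0
  have "stack 0 {} {} = {}" by (auto simp: stack_def)
  then show ?case
    using 0 by (simp add: W_ground W_side W_def[of 0 "{}" "{}"] fillings_empty T_0)
next
  case (Suc n)
  have "square - S \<in> sides"
    using Suc.prems by (auto simp: sides_def square_def insert_Diff_if)
  then show ?case
    using Suc W_shift[of "int n + 1" S] by (simp add: W_side T_Suc_eq_W add.commute)
qed

text \<open>
  The corner \<open>(1, 1)\<close> has a horizontal domino in the first two terms. Otherwise it is joined to the
  cube below. Then \<open>(2, 1)\<close> and \<open>(2, 2)\<close> form a domino in the third term, \<open>(1, 2)\<close> and \<open>(2, 2)\<close> do so
  in the fourth, and all four corners reach down in the last.
\<close>
lemma W_square:
  "W h square square = W h square {(2, 1), (2, 2)} + W h square {(1, 2), (2, 2)}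
    + W h {(2, 1), (2, 2)} {} + W h {(1, 2), (2, 2)} {} + W h {} {}"
proof -
  let ?U = "{(1, 2), (2, 1), (2, 2)} :: (int \<times> int) set"
  have "W h square square = W h ?U ?U + W h square {(1, 2), (2, 2)} + W h square {(2, 1), (2, 2)}"
    by (subst W_expand[where x = 1 and y = 1]) (auto simp: square_def insert_Diff_if)
  also have "W h ?U ?U = W h {(2, 1), (2, 2)} {(2, 1), (2, 2)} + W h ?U {(2, 1)}"
    by (subst W_expand[where x = 1 and y = 2]) (auto simp: square_def insert_Diff_if)
  also have "W h {(2, 1), (2, 2)} {(2, 1), (2, 2)} = W h {(2, 2)} {(2, 2)} + W h {(2, 1), (2, 2)} {}"
    by (subst W_expand[where x = 2 and y = 1]) (auto simp: square_def insert_Diff_if)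
  also have "W h {(2, 2)} {(2, 2)} = W h {} {}"
    by (subst W_expand[where x = 2 and y = 2]) (auto simp: square_def insert_Diff_if)
  also have "W h ?U {(2, 1)} = W h {(1, 2), (2, 2)} {}"
    by (subst W_expand[where x = 2 and y = 1]) (auto simp: square_def insert_Diff_if)
  finally show ?thesis by simp
qed

section \<open>Recurrences and the closed form\<close>

lemma T_1: "T 1 = 2"
proof -
  have "T 1 = W 0 {} square"
    using T_Suc_eq_W[of 0] by (simp add: W_ground)
  also have "\<dots> = W 0 {} {(1, 2), (2, 2)} + W 0 {} {(2, 1), (2, 2)}"
    by (subst W_expand[where x = 1 and y = 1]) (auto simp: square_def insert_Diff_if)
  also have "\<dots> = 2 * T 0"
    using W_side_eq_sum[of _ 0] by (simp add: sides_def W_ground)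
  finally show ?thesis by (simp add: T_0)
qed

lemma T_add_2: "T (n + 2) = 2 * (\<Sum>k\<le>n + 1. T k) + 2 * (\<Sum>k\<le>n. T k) + T n"
proof -
  have "T (n + 2) = W (int n + 1) square square"
    using T_Suc_eq_W[of "n + 1"] W_shift[of "int n + 1" square] by (simp add: add.commute)
  moreover have "W (int n + 1) square S = (\<Sum>k\<le>n + 1. T k)" if "S \<in> sides" for S
    using W_side_eq_sum[OF that, of "n + 1"] W_shift[of "int n + 1" S] by (simp add: add.commute)
  ultimately show ?thesis
    using W_side_eq_sum[of _ n] by (simp add: W_square sides_def T_eq_W[of n])
qed

lemma T_add_3: "T (n + 3) + T n = 3 * T (n + 2) + 3 * T (n + 1)"
  using T_add_2[of n] T_add_2[of "n + 1"] by (simp add: numeral_eq_Suc)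

lemma T_closed_form:
  "real (T n) = 1/6 * (2 + sqrt 3) ^ (n + 1) + 1/6 * (2 - sqrt 3) ^ (n + 1) + 1/3 * (- 1) ^ n"
proof -
  \<comment> \<open>Naming the powers keeps the simplifier from unfolding them when the recurrences are combined.\<close>
  define c where "c r n = (r::real) ^ n" for r n
  have c: "c r (n + 3) = 3 * c r (n + 2) + 3 * c r (n + 1) - c r n"
    if "(r + 1) * (r\<^sup>2 - 4 * r + 1) = 0" for r n
  proof -
    have "r ^ 3 = 3 * r\<^sup>2 + 3 * r - 1"
      using that by (simp add: algebra_simps power2_eq_square power3_eq_cube)
    then have "r ^ n * r ^ 3 = r ^ n * (3 * r\<^sup>2 + 3 * r - 1)" by simp
    then show ?thesis
      unfolding c_def power_add power_one_right by (simp only: right_diff_distrib distrib_left mult_1_right mult_ac)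
  qed
  have roots: "(r + 1) * (r\<^sup>2 - 4 * r + 1) = 0" if "r \<in> {2 + sqrt 3, 2 - sqrt 3, - 1}" for r
  proof -
    have "r = 2 + sqrt 3 \<or> r = 2 - sqrt 3 \<or> r = - 1"
      using that by simp
    then show ?thesis
      by (elim disjE; hypsubst) (simp_all add: power2_eq_square algebra_simps)
  qed
  define f where "f n = 1/6 * c (2 + sqrt 3) (n + 1) + 1/6 * c (2 - sqrt 3) (n + 1) + 1/3 * c (- 1) n"
    for n
  have f_rec: "f (n + 3) = 3 * f (n + 2) + 3 * f (n + 1) - f n" for n
    using c[OF roots, of "2 + sqrt 3" "n + 1"] c[OF roots, of "2 - sqrt 3" "n + 1"]
      c[OF roots, of "- 1" n]
    by (simp add: f_def algebra_simps)
  have T_2: "T 2 = 9"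
    using T_add_2[of 0] T_0 T_1 by (simp add: numeral_eq_Suc)
  have f_0: "f 0 = 1" and f_1: "f 1 = 2" and f_2: "f 2 = 9"
    by (simp_all add: f_def c_def eval_nat_numeral algebra_simps)
  have "real (T n) = f n"
  proof (induction n rule: less_induct)
    case (less n)
    consider "n = 0" | "n = 1" | "n = 2" | m where "n = m + 3"
      by (metis One_nat_def Suc_1 add.commute less_2_cases less_Suc_eq not_less le_Suc_ex numeral_3_eq_3)
    then show ?case
    proof cases
      case 4
      have "real (T (m + 3)) + real (T m) = 3 * real (T (m + 2)) + 3 * real (T (m + 1))"
        using T_add_3[of m] by linarith
      then show ?thesis
        using less[of m] less[of "m + 1"] less[of "m + 2"] f_rec[of m] 4 by simp
    qed (simp_all add: T_0 T_1[simplified] T_2 f_0 f_1[simplified] f_2)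
  qed
  then show ?thesis by (simp add: f_def c_def)
qed

theorem theorem3p1:
  fixes n :: nat
  assumes "n \<ge> 1"
  shows "real (T n) = 1/6 * (2 + sqrt 3) ^ (n + 1) + 1/6 * (2 - sqrt 3) ^ (n + 1) + 1/3 * (- 1) ^ n"
  by (rule T_closed_form)

end
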